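(* Let $\Theta\in\mathfrak I_c$ and $a\in\mathbb D$. If $\Theta(a)=0$, then $v:=\Theta/\varphi_a$ (with the removable singularity at $a$ removed) belongs to $\mathfrak I_c$.
   Context: $\mathbb D$ is the open unit disk in $\mathbb C$, and $H^\infty$ is the algebra of bounded holomorphic functions on $\mathbb D$. An inner function is a function $u\in H^\infty$ whose radial limits have modulus $1$ almost everywhere on the unit circle $\mathbb T$. For an inner function $u$ and $\eta\in\,]0,1[$ put $\Omega_u(\eta):=\{z\in\mathbb D: |u(z)|<\eta\}$. An inner function $u$ is called a one-component inner function if there is $\eta\in\,]0,1[$ such that $\Omega_u(\eta)$ is connected; unimodular constants are considered to be one-component inner functions. $\mathfrak I_c$ denotes the set of all one-component inner functions. For $a\in\mathbb D\setminus\{0\}$, $\varphi_a(z)=\frac{|a|}{a}\,\frac{a-z}{1-\overline a z}$, and $\varphi_0(z)=z$. *)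

theory Defs
  imports "HOL-Complex_Analysis.Complex_Analysis"
begin

(* Functions on the unit disk are total functions on the complex plane; every notion below
   depends only on the values on "ball 0 1". *)

definition Hinfty :: "(complex \<Rightarrow> complex) set" where
  "Hinfty = {u. u holomorphic_on ball 0 1 \<and> bounded (u ` ball 0 1)}"

definition has_radial_limit :: "(complex \<Rightarrow> complex) \<Rightarrow> complex \<Rightarrow> complex \<Rightarrow> bool" where
  "has_radial_limit u \<zeta> l \<longleftrightarrow> ((\<lambda>r::real. u (of_real r * \<zeta>)) \<longlongrightarrow> l) (at_left 1)"

(* "Almost everywhere on the unit circle" refers to arc length measure, which is Lebesgue
   measure of the angle. *)
definition inner_fun :: "(complex \<Rightarrow> complex) \<Rightarrow> bool" where
  "inner_fun u \<longleftrightarrow> u \<in> Hinfty \<and>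
     (AE t in lebesgue_on {0..2*pi}. \<exists>l. has_radial_limit u (cis t) l \<and> cmod l = 1)"

definition sublevel :: "(complex \<Rightarrow> complex) \<Rightarrow> real \<Rightarrow> complex set" where
  "sublevel u \<eta> = {z \<in> ball 0 1. cmod (u z) < \<eta>}"

(* The second disjunct is the convention on unimodular constants, whose sublevel sets are
   empty; it makes the definition independent of whether the empty set counts as connected. *)
definition one_component_inner :: "(complex \<Rightarrow> complex) set" where
  "one_component_inner = {u. inner_fun u \<and>
     ((\<exists>\<eta>\<in>{0<..<1}. connected (sublevel u \<eta>)) \<or>
      (\<exists>c. cmod c = 1 \<and> (\<forall>z\<in>ball 0 1. u z = c)))}"

definition blaschke_factor :: "complex \<Rightarrow> complex \<Rightarrow> complex" where
  "blaschke_factor a z =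
     (if a = 0 then z else of_real (cmod a) / a * ((a - z) / (1 - cnj a * z)))"

end

(* Put v = \<Theta>/\<phi>_a and let \<Omega>_\<Theta>(\<eta>) be connected. Since |\<phi>_a| > \<rho> off a compact subset of the disk,
   on which |v| is bounded by some m < 1 (unless v is a unimodular constant), we get
   \<Omega>_\<Theta>(\<eta>) \<subseteq> \<Omega>_v(\<eta>') as soon as \<eta>' > max(\<eta>/\<rho>, m). It remains to see that each component C of
   \<Omega>_v(\<eta>') meets \<Omega>_\<Theta>(\<eta>). As |\<Theta>| \<le> |v|, it suffices that inf |v| = 0 on C; otherwise \<eta>'/v is bounded
   and holomorphic on C and of modulus 1 on the part of the boundary of C inside the disk, while
   almost every radius eventually leaves C because |v| tends to 1 along it. A maximum principle for
   this situation gives |v| \<ge> \<eta>' on C, which is absurd.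

   The maximum principle amounts to this: a bounded nonnegative subharmonic function whose radial
   limits vanish almost everywhere is zero. Poisson integrals are avoided by approximating continuous
   functions on a circle by real parts of polynomials (Stone-Weierstrass). *)

theory Submission
  imports Defs
begin

section \<open>Harmonic majorants on a disk\<close>

text \<open>Since \<open>z * cnj z\<close> is constant on the circle, every mixed monomial reduces
  there to a constant times a pure power of \<open>z\<close> or of \<open>cnj z\<close>.\<close>

lemma circle_mult_poly_poly_cnj:
  "\<exists>p' q'. \<forall>z. cmod z = r \<longrightarrow>
           poly p z * poly q (cnj z) = poly p' z + poly q' (cnj z)"
proof (induction p arbitrary: q)
  case 0
  have "\<forall>z. cmod z = r \<longrightarrow> poly 0 z * poly q (cnj z) = poly 0 z + poly 0 (cnj z)" by simp
  then show ?case by blast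
next
  case (pCons a p)
  obtain p1 q1 where 1: "\<And>z. cmod z = r \<Longrightarrow> poly p z * poly q (cnj z) = poly p1 z + poly q1 (cnj z)"
    using pCons.IH by blast
  obtain b q2 where q1: "q1 = pCons b q2" by (cases q1)
  \<comment> \<open>In \<open>z * poly q1 (cnj z)\<close> the constant coefficient \<open>b\<close>
    yields \<open>b * z\<close>; every other monomial trades a factor \<open>z * cnj z\<close> for
    \<open>r\<^sup>2\<close>.\<close>
  have "poly (pCons a p) z * poly q (cnj z)
      = poly (pCons 0 p1 + [:0, b:]) z + poly (smult a q + smult (of_real (r\<^sup>2)) q2) (cnj z)"
    if z: "cmod z = r" for z
  proof -
    have zz: "z * cnj z = of_real (r\<^sup>2)"
      using z by (simp add: complex_norm_square[symmetric])
    have "poly (pCons a p) z * poly q (cnj z) = a * poly q (cnj z) + z * (poly p z * poly q (cnj z))"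
      by (simp add: algebra_simps)
    also have "\<dots> = a * poly q (cnj z) + z * poly p1 z + b * z + (z * cnj z) * poly q2 (cnj z)"
      unfolding 1[OF z] q1 by (simp add: algebra_simps)
    finally show ?thesis unfolding zz by (simp add: algebra_simps)
  qed
  then show ?case by blast
qed

text \<open>The right-hand side is harmonic in the whole plane, so this solves the Dirichlet problem
  for polynomial data. Of the generators, only the product needs the restriction to the
  circle.\<close>

lemma real_polynomial_on_circle:
  fixes f :: "complex \<Rightarrow> real"
  assumes "real_polynomial_function f"
  shows "\<exists>p q. \<forall>z. cmod z = r \<longrightarrow> of_real (f z) = poly p z + poly q (cnj z)"
  using assms
proof (induction rule: real_polynomial_function.induct)
  case (linear f)
  interpret bounded_linear f by fact
  \<comment> \<open>The coefficients come from \<open>Re z = (z + cnj z) / 2\<close> and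
    \<open>Im z = (z - cnj z) / (2 * \<i>)\<close>.\<close>
  have "of_real (f z) = poly [:0, (of_real (f 1) - \<i> * of_real (f \<i>)) / 2:] z
          + poly [:0, (of_real (f 1) + \<i> * of_real (f \<i>)) / 2:] (cnj z)" for z
  proof -
    have "z = Re z *\<^sub>R 1 + Im z *\<^sub>R \<i>"
      by (simp add: complex_eq_iff)
    then have "f z = Re z * f 1 + Im z * f \<i>"
      by (metis add scale real_scaleR_def)
    then show ?thesis by (simp add: complex_eq_iff field_simps)
  qed
  then show ?case by blast
next
  case (const c)
  have "of_real c = poly [:of_real c:] z + poly 0 (cnj z)" for z :: complex by simp
  then show ?case by blast
next
  case (add f g)
  then obtain p q p' q' where
    "\<And>z. cmod z = r \<Longrightarrow> of_real (f z) = poly p z + poly q (cnj z)"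
    "\<And>z. cmod z = r \<Longrightarrow> of_real (g z) = poly p' z + poly q' (cnj z)" by blast
  then have "\<forall>z. cmod z = r \<longrightarrow> of_real (f z + g z) = poly (p + p') z + poly (q + q') (cnj z)"
    by simp
  then show ?case by blast
next
  case (mult f g)
  then obtain p q p' q' where
    *: "\<And>z. cmod z = r \<Longrightarrow> of_real (f z) = poly p z + poly q (cnj z)"
    "\<And>z. cmod z = r \<Longrightarrow> of_real (g z) = poly p' z + poly q' (cnj z)" by blast
  obtain p1 q1 where 1: "\<And>z. cmod z = r \<Longrightarrow> poly p z * poly q' (cnj z) = poly p1 z + poly q1 (cnj z)"
    using circle_mult_poly_poly_cnj by blast
  obtain p2 q2 where 2: "\<And>z. cmod z = r \<Longrightarrow> poly p' z * poly q (cnj z) = poly p2 z + poly q2 (cnj z)"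
    using circle_mult_poly_poly_cnj by blast
  have "of_real (f z * g z) = poly (p * p' + p1 + p2) z + poly (q * q' + q1 + q2) (cnj z)"
    if z: "cmod z = r" for z
  proof -
    have "of_real (f z * g z) = poly p z * poly p' z + poly q (cnj z) * poly q' (cnj z)
        + poly p z * poly q' (cnj z) + poly p' z * poly q (cnj z)"
      using *[OF z] by (simp add: algebra_simps)
    then show ?thesis unfolding 1[OF z] 2[OF z] by simp
  qed
  then show ?case by blast
qed

lemma continuous_on_circle_approx_Re_poly:
  fixes g :: "complex \<Rightarrow> real"
  assumes g: "continuous_on (sphere 0 r) g" and "\<epsilon> > 0"
  obtains q where "\<And>z. cmod z = r \<Longrightarrow> g z < Re (poly q z)" "\<And>z. cmod z = r \<Longrightarrow> Re (poly q z) < g z + \<epsilon>"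
proof -
  obtain h where h: "real_polynomial_function h" "\<And>x. x \<in> sphere 0 r \<Longrightarrow> \<bar>g x - h x\<bar> < \<epsilon>/2"
    using Stone_Weierstrass_real_polynomial_function[of "sphere 0 r" g "\<epsilon>/2"] assms by auto
  obtain p q where pq: "\<And>z. cmod z = r \<Longrightarrow> of_real (h z) = poly p z + poly q (cnj z)"
    using real_polynomial_on_circle[OF h(1)] by blast
  \<comment> \<open>Conjugating the coefficients turns \<open>poly q (cnj z)\<close> into a
    polynomial in \<open>z\<close> with the same real part; the shift by \<open>\<epsilon>/2\<close>
    turns a two-sided error into a strict majorant.\<close>
  define P where "P = p + map_poly cnj q + [:of_real (\<epsilon>/2):]"
  have *: "Re (poly P z) = h z + \<epsilon>/2" if "cmod z = r" for z
  proof -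
    have "poly (map_poly cnj q) z = cnj (poly q (cnj z))"
      using poly_cnj[of q "cnj z"] by simp
    then have "Re (poly P z) = Re (poly p z + poly q (cnj z)) + \<epsilon>/2"
      by (simp add: P_def)
    also have "\<dots> = h z + \<epsilon>/2" by (simp flip: pq[OF that])
    finally show ?thesis .
  qed
  show ?thesis
  proof (rule that[of P])
    fix z :: complex assume z: "cmod z = r"
    then have "\<bar>g z - h z\<bar> < \<epsilon>/2" using h(2) by simp
    then show "g z < Re (poly P z)" "Re (poly P z) < g z + \<epsilon>"
      unfolding *[OF z] by linarith+
  qed
qed

lemma Harnack_upper:
  assumes hol: "q holomorphic_on ball 0 r" and pos: "\<And>z. cmod z < r \<Longrightarrow> Re (q z) > 0"
    and z: "cmod z < r"
  shows "Re (q z) \<le> (r + cmod z) / (r - cmod z) * Re (q 0)"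
proof -
  have r: "r > 0" using z norm_ge_zero[of z] by linarith
  have rw: "cmod (of_real r * w) < r" if "cmod w < 1" for w
    using that r by (simp add: norm_mult)
  \<comment> \<open>Map the right half-plane to the disk by a Cayley transform and use the Schwarz lemma.\<close>
  define f where "f w = (q (of_real r * w) - q 0) / (q (of_real r * w) + cnj (q 0))" for w
  have nz: "q (of_real r * w) + cnj (q 0) \<noteq> 0" if "cmod w < 1" for w
  proof
    assume "q (of_real r * w) + cnj (q 0) = 0"
    then have "Re (q (of_real r * w)) + Re (q 0) = 0" by (metis complex_cnj(1) cnj.simps(1) plus_complex.simps(1) zero_complex.simps(1))
    then show False using pos[OF rw[OF that]] pos[of 0] r by simp
  qed
  have less: "cmod (f w) < 1" if w: "cmod w < 1" for w
  proof -
    define A where "A = q (of_real r * w)"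
    have A: "Re A > 0" using pos[OF rw[OF w]] by (simp add: A_def)
    have B: "Re (q 0) > 0" using pos[of 0] r by simp
    \<comment> \<open>The right side exceeds the left by \<open>4 * Re A * Re (q 0)\<close>.\<close>
    have "(cmod (A - q 0))\<^sup>2 < (cmod (A + cnj (q 0)))\<^sup>2"
      using mult_pos_pos[OF A B] unfolding cmod_power2 by (simp add: power2_eq_square algebra_simps)
    then have "cmod (A - q 0) < cmod (A + cnj (q 0))"
      by (simp add: power2_less_imp_less)
    then show ?thesis
      by (simp add: f_def A_def[symmetric] norm_divide divide_simps)
  qed
  define w where "w = z / of_real r"
  have w: "cmod w < 1" "of_real r * w = z" using z r by (auto simp: w_def norm_divide)
  have "f holomorphic_on ball 0 1"
    unfolding f_def using nz rw
    by (intro holomorphic_intros holomorphic_on_compose_gen[OF _ hol, unfolded o_def]) auto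
  then have fw: "cmod (f w) \<le> cmod w"
    by (rule Schwarz_Lemma(1)) (use less w in \<open>auto simp: f_def\<close>)
  have f1: "f w \<noteq> 1" using less[OF w(1)] by auto
  have "q z - q 0 = f w * (q z + cnj (q 0))"
    using nz[OF w(1)] by (simp add: f_def w)
  then have "q z * (1 - f w) = q 0 + f w * cnj (q 0)" by (simp add: algebra_simps)
  \<comment> \<open>After division by \<open>1 - f w\<close>, the imaginary part of
    \<open>q 0\<close> contributes only a purely imaginary constant.\<close>
  also have "\<dots> = of_real (Re (q 0)) * (1 + f w) + \<i> * of_real (Im (q 0)) * (1 - f w)"
    by (simp add: complex_eq_iff algebra_simps)
  finally have "q z = of_real (Re (q 0)) * ((1 + f w) / (1 - f w)) + \<i> * of_real (Im (q 0))"
    using f1 by (simp add: field_simps)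
  then have "Re (q z) = Re (q 0) * Re ((1 + f w) / (1 - f w))"
    by (simp only: plus_complex.sel Re_i_times Im_complex_of_real Re_complex_of_real times_complex.sel
        imaginary_unit.sel)
  also have "\<dots> \<le> Re (q 0) * ((r + cmod z) / (r - cmod z))"
  proof (rule mult_left_mono)
    have "Re ((1 + f w) / (1 - f w)) \<le> cmod (1 + f w) / cmod (1 - f w)"
      by (metis complex_Re_le_cmod norm_divide)
    also have "\<dots> \<le> (1 + cmod w) / (1 - cmod w)"
    proof (rule frac_le)
      show "cmod (1 + f w) \<le> 1 + cmod w" using norm_triangle_ineq[of 1 "f w"] fw by simp
      show "1 - cmod w \<le> cmod (1 - f w)" using norm_triangle_ineq2[of 1 "f w"] fw by simp
    qed (use w in auto)
    also have "\<dots> = (r + cmod z) / (r - cmod z)"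
      using r z by (simp add: w_def norm_divide field_simps)
    finally show "Re ((1 + f w) / (1 - f w)) \<le> (r + cmod z) / (r - cmod z)" .
    show "Re (q 0) \<ge> 0" using pos[of 0] r by simp
  qed
  finally show ?thesis by (simp add: mult.commute)
qed

text \<open>This is Cauchy's formula at the centre: the kernel cancels the derivative of the
  parametrisation up to \<open>\<i>\<close>, and \<open>Im (\<i> * w) = Re w\<close>.\<close>

lemma Re_mean_value:
  assumes "q holomorphic_on cball 0 r" "r > 0"
  shows "((\<lambda>t. Re (q (of_real r * cis t))) has_integral (2 * pi * Re (q 0))) {0..2*pi}"
proof -
  have "((\<lambda>u. q u/(u-0)) has_contour_integral (2 * of_real pi * \<i> * q 0)) (part_circlepath 0 r 0 (2*pi))"
    using Cauchy_integral_circlepath_simple[of q 0 r 0] assms by (simp add: circlepath_def)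
  then have "((\<lambda>t. q (of_real r * cis t) / (of_real r * cis t) * of_real r * \<i> * cis t) has_integral
       (2 * of_real pi * \<i> * q 0)) {0..2*pi}"
    by (subst (asm) has_contour_integral_part_circlepath_iff) auto
  then have "((\<lambda>t. \<i> * q (of_real r * cis t)) has_integral (2 * of_real pi * \<i> * q 0)) {0..2*pi}"
    by (rule has_integral_eq[rotated]) (use assms in auto)
  from has_integral_linear[OF this bounded_linear_Im] show ?thesis
    by (simp add: o_def)
qed

section \<open>A maximum principle with exceptional boundary\<close>

text \<open>On the part of \<open>frontier C\<close> lying on the unit circle nothing is known about \<open>f\<close> itself; the
  hypothesis \<open>rad\<close> says that almost every radius leaves \<open>C\<close> before reaching the circle.\<close>

lemma maximum_principle_AE_radial:
  assumes "open C" and sub: "C \<subseteq> ball 0 1" and hol: "f holomorphic_on C"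
    and cont: "continuous_on (closure C \<inter> ball 0 1) f"
    and bd: "\<And>z. z \<in> C \<Longrightarrow> cmod (f z) \<le> M"
    and fr: "\<And>z. z \<in> frontier C \<Longrightarrow> z \<in> ball 0 1 \<Longrightarrow> cmod (f z) \<le> 1"
    and rad: "AE t in lebesgue_on {0..2*pi}. \<forall>\<^sub>F r in at_left 1. of_real r * cis t \<notin> C"
    and z0: "z0 \<in> C"
  shows "cmod (f z0) \<le> 1"
proof -
  \<comment> \<open>\<open>g\<close> is a bounded continuous subharmonic function on the disk; \<open>key\<close> bounds it by the Harnack
    constant times its mean over the circle of radius \<open>r\<close>, and this mean vanishes as \<open>r \<rightarrow> 1\<close>.\<close>
  define g where "g z = (if z \<in> C then ln (max 1 (cmod (f z))) else 0)" for z
  define I where "I r = integral {0..2*pi} (\<lambda>t. g (of_real r * cis t))" for r :: real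
  define L where "L = ln (max 1 (cmod (f z0)))"
  have g_ge: "g z \<ge> 0" for z by (simp add: g_def)
  have g_le: "g z \<le> ln (max 1 M)" for z
    using bd[of z] by (auto simp: g_def intro!: ln_mono)
  have contg: "continuous_on (ball 0 1) g"
  proof -
    have U: "ball 0 1 = (closure C \<inter> ball 0 1) \<union> (ball 0 1 - C)"
      using closure_subset by auto
    have "continuous_on ((closure C \<inter> ball 0 1) \<union> (ball 0 1 - C)) g"
      unfolding g_def
    proof (rule continuous_on_cases_local)
      show "closedin (top_of_set (closure C \<inter> ball 0 1 \<union> (ball 0 1 - C))) (closure C \<inter> ball 0 1)"
        unfolding U[symmetric] by (auto simp: closedin_closed)
      show "closedin (top_of_set (closure C \<inter> ball 0 1 \<union> (ball 0 1 - C))) (ball 0 1 - C)"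
        unfolding U[symmetric] using \<open>open C\<close> by (auto simp: closedin_closed intro!: exI[of _ "-C"])
      show "continuous_on (closure C \<inter> ball 0 1) (\<lambda>z. ln (max 1 (cmod (f z))))"
        by (intro continuous_intros cont) auto
      show "continuous_on (ball 0 1 - C) (\<lambda>z. 0::real)" by simp
      \<comment> \<open>The branches meet only at frontier points of \<open>C\<close> inside the
        disk, where \<open>cmod (f x) \<le> 1\<close> makes the logarithm vanish.\<close>
      show "ln (max 1 (cmod (f x))) = 0"
        if "x \<in> closure C \<inter> ball 0 1 \<and> x \<notin> C \<or> x \<in> ball 0 1 - C \<and> x \<in> C" for x
        using that fr[of x] \<open>open C\<close> by (auto simp: frontier_def interior_open max_def)
    qed
    then show ?thesis using U by simp
  qed
  have circ: "of_real r * cis t \<in> ball 0 1" if "0 \<le> r" "r < 1" for r t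
    using that by (simp add: norm_mult)
  have contI: "continuous_on {0..2*pi} (\<lambda>t. g (of_real r * cis t))" if "0 \<le> r" "r < 1" for r
    by (intro continuous_on_compose2[OF contg] continuous_intros) (use circ[OF that] in auto)
  have key: "2 * pi * L \<le> (r + cmod z0) / (r - cmod z0) * I r" if r: "cmod z0 < r" "r < 1" for r
  proof -
    define K where "K = (r + cmod z0) / (r - cmod z0)"
    have r0: "r > 0" using r norm_ge_zero[of z0] by linarith
    have K: "K > 0" using r r0 by (auto simp: K_def intro!: divide_pos_pos add_pos_nonneg)
    have "2 * pi * L \<le> K * I r + e" if "e > 0" for e
    proof -
      \<comment> \<open>Chosen so that the total error \<open>K * (2 * pi * (2 * d))\<close> equals
        \<open>e\<close>.\<close>
      define d where "d = e / (4 * pi * K)"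
      have d: "d > 0" using K that by (simp add: d_def)
      have "continuous_on (sphere 0 r) (\<lambda>z. g z + d)"
        by (intro continuous_intros continuous_on_subset[OF contg]) (use r in auto)
      from continuous_on_circle_approx_Re_poly[OF this d] obtain q
        where q1: "\<And>z. cmod z = r \<Longrightarrow> g z + d < Re (poly q z)"
          and q2: "\<And>z. cmod z = r \<Longrightarrow> Re (poly q z) < g z + d + d" by blast
      \<comment> \<open>The minimum principle for \<open>Re (poly q z)\<close>, in the form of the
        maximum modulus principle for \<open>exp (- poly q z)\<close>; on the circle the real part
        exceeds \<open>d\<close> because \<open>g\<close> is nonnegative.\<close>
      have qpos: "Re (poly q z) > 0" if "cmod z \<le> r" for z
      proof -
        have "cmod (exp (- poly q z)) \<le> exp (- d)"
        proof (rule maximum_modulus_frontier[where S = "cball 0 r" and f = "\<lambda>z. exp (- poly q z)"])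
          show "cmod (exp (- poly q z)) \<le> exp (- d)" if "z \<in> frontier (cball 0 r)" for z
            using q1[of z] g_ge[of z] that r0 by simp
        qed (use that in \<open>auto intro!: holomorphic_intros continuous_intros\<close>)
        then show ?thesis using d by simp
      qed
      have quot: "cmod (f z * exp (- poly q z)) = cmod (f z) / exp (Re (poly q z))" for z
        by (simp only: norm_mult norm_exp_eq_Re norm_inverse exp_minus divide_inverse)
      \<comment> \<open>Comparing \<open>ln (cmod (f z))\<close> with \<open>Re (poly q z)\<close>
        multiplicatively keeps the function holomorphic even at zeros of \<open>f\<close>. Its bound
        is checked on two kinds of frontier points: those in \<open>C\<close> on the circle of
        radius \<open>r\<close>, and those on the frontier of \<open>C\<close>.\<close>
      have "cmod (f z0 * exp (- poly q z0)) \<le> 1"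
      proof (rule maximum_modulus_frontier[where S = "C \<inter> ball 0 r" and f = "\<lambda>z. f z * exp (- poly q z)"])
        have cl: "closure (C \<inter> ball 0 r) \<subseteq> closure C \<inter> cball 0 r"
          by (intro Int_greatest closure_mono closure_minimal) auto
        show "(\<lambda>z. f z * exp (- poly q z)) holomorphic_on interior (C \<inter> ball 0 r)"
          by (intro holomorphic_intros holomorphic_on_subset[OF hol]) (use interior_subset in blast)+
        show "continuous_on (closure (C \<inter> ball 0 r)) (\<lambda>z. f z * exp (- poly q z))"
          by (intro continuous_intros continuous_on_subset[OF cont]) (use cl r in force)
        show "bounded (C \<inter> ball 0 r)" by (simp add: bounded_Int)
        show "z0 \<in> C \<inter> ball 0 r" using z0 r by simp
        show "cmod (f z * exp (- poly q z)) \<le> 1" if z: "z \<in> frontier (C \<inter> ball 0 r)" for z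
        proof -
          have zz: "z \<in> closure C" "cmod z \<le> r" "z \<notin> C \<inter> ball 0 r"
            using z cl \<open>open C\<close> by (auto simp: frontier_def interior_open open_Int)
          have "cmod (f z) \<le> exp (Re (poly q z))"
          proof (cases "z \<in> C")
            case True
            then have "cmod z = r" using zz by auto
            then have "ln (max 1 (cmod (f z))) \<le> Re (poly q z)"
              using q1[of z] d True by (simp add: g_def)
            then have "exp (ln (max 1 (cmod (f z)))) \<le> exp (Re (poly q z))"
              by (simp only: exp_le_cancel_iff)
            then show ?thesis by (subst (asm) exp_ln) auto
          next
            case False
            then have "cmod (f z) \<le> 1"
              using fr[of z] zz r \<open>open C\<close> by (auto simp: frontier_def interior_open)
            also have "1 \<le> exp (Re (poly q z))" using qpos[OF zz(2)] by simp
            finally show ?thesis .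
          qed
          then show ?thesis by (simp only: quot) (simp add: field_simps)
        qed
      qed
      then have "cmod (f z0) \<le> exp (Re (poly q z0))"
        by (simp only: quot) (simp add: field_simps)
      then have "max 1 (cmod (f z0)) \<le> exp (Re (poly q z0))"
        using qpos[of z0] r by simp
      then have "ln (max 1 (cmod (f z0))) \<le> ln (exp (Re (poly q z0)))"
        by (intro ln_mono) auto
      then have "L \<le> Re (poly q z0)" by (simp add: L_def)
      also have "\<dots> \<le> K * Re (poly q 0)"
        unfolding K_def
        by (rule Harnack_upper) (use qpos r in \<open>auto intro!: holomorphic_intros\<close>)
      finally have "2 * pi * L \<le> K * (2 * pi * Re (poly q 0))"
        by (simp add: algebra_simps mult_left_mono)
      also have "\<dots> \<le> K * (I r + 2 * pi * (2 * d))"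
      proof (rule mult_left_mono)
        have "((\<lambda>t. g (of_real r * cis t)) has_integral I r) {0..2*pi}"
          unfolding I_def using contI[of r] r r0 by (intro integrable_integral integrable_continuous_real) auto
        moreover have "((\<lambda>t. 2 * d) has_integral (2 * pi * (2 * d))) {0..2*pi}"
          using has_integral_const_real[of "2*d" 0 "2*pi"] by simp
        ultimately have maj: "((\<lambda>t. g (of_real r * cis t) + 2 * d) has_integral (I r + 2 * pi * (2 * d))) {0..2*pi}"
          by (rule has_integral_add)
        have mean: "((\<lambda>t. Re (poly q (of_real r * cis t))) has_integral (2 * pi * Re (poly q 0))) {0..2*pi}"
          by (rule Re_mean_value) (use r0 in \<open>auto intro!: holomorphic_intros\<close>)
        show "2 * pi * Re (poly q 0) \<le> I r + 2 * pi * (2 * d)"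
        proof (rule has_integral_le[OF mean maj])
          fix t
          have "cmod (of_real r * cis t) = r" using r0 by (simp add: norm_mult)
          from q2[OF this] show "Re (poly q (of_real r * cis t)) \<le> g (of_real r * cis t) + 2 * d"
            by simp
        qed
      qed (use K in simp)
      also have "\<dots> = K * I r + e"
        using K by (simp add: d_def field_simps)
      finally show ?thesis .
    qed
    then show ?thesis unfolding K_def by (rule field_le_epsilon)
  qed
  \<comment> \<open>The radii start at 0 and stay below 1, so \<open>g\<close> is continuous on all
    these circles.\<close>
  define \<rho> where "\<rho> n = 1 - inverse (real (Suc n))" for n
  have \<rho>: "\<rho> n \<ge> 0" "\<rho> n < 1" for n by (auto simp: \<rho>_def field_simps)
  have \<rho>_lim: "\<rho> \<longlonglongrightarrow> 1"
    unfolding \<rho>_def using tendsto_diff[OF tendsto_const LIMSEQ_inverse_real_of_nat, of 1] by simp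
  then have \<rho>_left: "filterlim \<rho> (at_left 1) sequentially"
    using \<rho> by (auto simp: filterlim_at intro!: always_eventually dest: less_imp_neq)
  \<comment> \<open>For almost every angle the integrand is eventually 0, since \<open>g\<close>
    vanishes off \<open>C\<close>; a constant dominates it on the bounded interval.\<close>
  have "(\<lambda>n. integral\<^sup>L (lebesgue_on {0..2*pi}) (\<lambda>t. g (of_real (\<rho> n) * cis t)))
          \<longlonglongrightarrow> integral\<^sup>L (lebesgue_on {0..2*pi}) (\<lambda>t. 0)"
  proof (rule integral_dominated_convergence[where w = "\<lambda>t. ln (max 1 M)"])
    show "(\<lambda>t. g (of_real (\<rho> n) * cis t)) \<in> borel_measurable (lebesgue_on {0..2*pi})" for n
      using contI[OF \<rho>] by (intro continuous_imp_measurable_on_sets_lebesgue) auto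
    show "AE t in lebesgue_on {0..2*pi}. (\<lambda>n. g (of_real (\<rho> n) * cis t)) \<longlonglongrightarrow> 0"
      using rad
    proof eventually_elim
      case (elim t)
      have "\<forall>\<^sub>F n in sequentially. of_real (\<rho> n) * cis t \<notin> C"
        using eventually_compose_filterlim[OF elim \<rho>_left] .
      then have "\<forall>\<^sub>F n in sequentially. g (of_real (\<rho> n) * cis t) = 0"
        by eventually_elim (simp add: g_def)
      then show ?case by (simp add: tendsto_eventually)
    qed
    show "AE t in lebesgue_on {0..2*pi}. norm (g (of_real (\<rho> n) * cis t)) \<le> ln (max 1 M)" for n
      using g_ge g_le by simp
  qed (auto intro!: continuous_imp_integrable_real)
  moreover have "integral\<^sup>L (lebesgue_on {0..2*pi}) (\<lambda>t. g (of_real (\<rho> n) * cis t)) = I (\<rho> n)" for n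
    unfolding I_def
    by (intro lebesgue_integral_eq_integral continuous_imp_integrable_real contI \<rho>) auto
  ultimately have "(\<lambda>n. I (\<rho> n)) \<longlonglongrightarrow> 0" by simp
  moreover have z1: "cmod z0 < 1" using z0 sub by auto
  \<comment> \<open>The Harnack factor has a finite limit because \<open>cmod z0 < 1\<close>, so the
    vanishing means force the product to 0.\<close>
  ultimately have "(\<lambda>n. (\<rho> n + cmod z0) / (\<rho> n - cmod z0) * I (\<rho> n))
      \<longlonglongrightarrow> (1 + cmod z0) / (1 - cmod z0) * 0"
    by (intro tendsto_intros \<rho>_lim) auto
  moreover have "\<forall>\<^sub>F n in sequentially. 2 * pi * L \<le> (\<rho> n + cmod z0) / (\<rho> n - cmod z0) * I (\<rho> n)"
    using order_tendstoD(1)[OF \<rho>_lim z1] by eventually_elim (use key \<rho> in auto)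
  ultimately have "2 * pi * L \<le> (1 + cmod z0) / (1 - cmod z0) * 0"
    by (rule tendsto_lowerbound) simp
  then have "L \<le> 0" by (metis mult_zero_right pi_gt_zero mult_le_cancel_left_pos mult.assoc zero_less_numeral zero_less_mult_iff)
  then have "max 1 (cmod (f z0)) \<le> 1"
    unfolding L_def by (subst (asm) ln_le_zero_iff) auto
  then show ?thesis by simp
qed

section \<open>Inner functions\<close>

lemma inner_fun_holomorphic: "inner_fun u \<Longrightarrow> u holomorphic_on ball 0 1"
  and inner_fun_bounded: "inner_fun u \<Longrightarrow> bounded (u ` ball 0 1)"
  by (auto simp: inner_fun_def Hinfty_def)

lemma inner_fun_continuous: "inner_fun u \<Longrightarrow> continuous_on (ball 0 1) u"
  by (intro holomorphic_on_imp_continuous_on inner_fun_holomorphic)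

lemma inner_fun_AE_norm_tendsto:
  assumes "inner_fun u"
  shows "AE t in lebesgue_on {0..2*pi}. ((\<lambda>r. cmod (u (of_real r * cis t))) \<longlongrightarrow> 1) (at_left 1)"
proof -
  have "AE t in lebesgue_on {0..2*pi}. \<exists>l. has_radial_limit u (cis t) l \<and> cmod l = 1"
    using assms by (simp add: inner_fun_def)
  then show ?thesis
    by eventually_elim (auto simp: has_radial_limit_def dest: tendsto_norm)
qed

text \<open>Otherwise the maximum principle applies to \<open>u / c\<close> on the set where
  \<open>cmod (u w) > c\<close>, for some \<open>c\<close> strictly between 1 and
  \<open>cmod (u z)\<close>: radial limits of modulus 1 drive almost every radius out of this
  set.\<close>

lemma inner_fun_norm_le_1:
  assumes u: "inner_fun u" and z: "z \<in> ball 0 1"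
  shows "cmod (u z) \<le> 1"
proof (rule ccontr)
  assume gt: "\<not> cmod (u z) \<le> 1"
  define c where "c = (1 + cmod (u z)) / 2"
  have c: "c > 1" "c < cmod (u z)" using gt by (auto simp: c_def)
  define C where "C = {w \<in> ball 0 1. c < cmod (u w)}"
  have "open (ball 0 1 \<inter> (\<lambda>w. cmod (u w)) -` {c<..})"
    by (intro continuous_open_preimage continuous_intros inner_fun_continuous u) auto
  also have "ball 0 1 \<inter> (\<lambda>w. cmod (u w)) -` {c<..} = C" by (auto simp: C_def)
  finally have "open C" .
  obtain M where M: "\<And>w. w \<in> ball 0 1 \<Longrightarrow> cmod (u w) \<le> M"
    using inner_fun_bounded[OF u] unfolding bounded_iff by blast
  have "cmod (u z / of_real c) \<le> 1"
  proof (rule maximum_principle_AE_radial[where f = "\<lambda>w. u w / of_real c"])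
    show "(\<lambda>w. u w / of_real c) holomorphic_on C"
      by (intro holomorphic_intros holomorphic_on_subset[OF inner_fun_holomorphic[OF u]])
         (use c in \<open>auto simp: C_def\<close>)
    show "continuous_on (closure C \<inter> ball 0 1) (\<lambda>w. u w / of_real c)"
      by (intro continuous_intros continuous_on_subset[OF inner_fun_continuous[OF u]]) (use c in auto)
    show "cmod (u w / of_real c) \<le> M / c" if "w \<in> C" for w
      using M[of w] that c by (auto simp: C_def norm_divide divide_right_mono)
    show "cmod (u w / of_real c) \<le> 1" if "w \<in> frontier C" "w \<in> ball 0 1" for w
      using that c \<open>open C\<close> by (auto simp: frontier_def interior_open C_def norm_divide)
    show "AE t in lebesgue_on {0..2*pi}. \<forall>\<^sub>F r in at_left 1. of_real r * cis t \<notin> C"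
      using inner_fun_AE_norm_tendsto[OF u]
    proof eventually_elim
      case (elim t)
      from order_tendstoD(2)[OF elim c(1)] show ?case
        by eventually_elim (auto simp: C_def)
    qed
  qed (use \<open>open C\<close> z c in \<open>auto simp: C_def\<close>)
  then show False using c by (simp add: norm_divide)
qed

lemma open_sublevel:
  assumes "inner_fun u"
  shows "open (sublevel u \<eta>)"
proof -
  have "open (ball 0 1 \<inter> (\<lambda>w. cmod (u w)) -` {..<\<eta>})"
    by (intro continuous_open_preimage continuous_intros inner_fun_continuous assms) auto
  also have "ball 0 1 \<inter> (\<lambda>w. cmod (u w)) -` {..<\<eta>} = sublevel u \<eta>" by (auto simp: sublevel_def)
  finally show ?thesis .
qed

text \<open>A lower bound \<open>\<delta>\<close> on \<open>C\<close> would bound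
  \<open>\<eta> / u\<close> there by \<open>\<eta> / \<delta>\<close>, and \<open>\<eta> < 1\<close>
  drives almost every radius out of \<open>C\<close>. The maximum principle would then give
  \<open>cmod (u z) \<ge> \<eta>\<close> inside the sublevel set.\<close>

lemma inner_fun_small_on_components:
  assumes u: "inner_fun u" and C: "C \<in> components (sublevel u \<eta>)" and "\<eta> < 1" "\<delta> > 0"
  shows "\<exists>z\<in>C. cmod (u z) < \<delta>"
proof (rule ccontr)
  assume "\<not> (\<exists>z\<in>C. cmod (u z) < \<delta>)"
  then have ge: "\<delta> \<le> cmod (u z)" if "z \<in> C" for z using that by force
  have sub: "C \<subseteq> sublevel u \<eta>" using C by (rule in_components_subset)
  have "open C" using C open_components open_sublevel[OF u] by blast
  obtain z where z: "z \<in> C" using in_components_nonempty[OF C] by blast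
  then have z\<eta>: "cmod (u z) < \<eta>" using sub by (auto simp: sublevel_def)
  then have \<eta>: "\<eta> > 0" using norm_ge_zero[of "u z"] by linarith
  have fr: "\<eta> \<le> cmod (u w)" if "w \<in> frontier C" "w \<in> ball 0 1" for w
  proof -
    \<comment> \<open>The whole sublevel set is open, hence disjoint from its frontier, which
      contains that of each component.\<close>
    have "w \<in> frontier (sublevel u \<eta>)" using frontier_of_components_subset[OF C] that by blast
    then have "w \<notin> sublevel u \<eta>" using open_sublevel[OF u] by (auto simp: frontier_def interior_open)
    then show ?thesis using that by (auto simp: sublevel_def)
  qed
  have nz: "u w \<noteq> 0" if "w \<in> closure C" "w \<in> ball 0 1" for w
    using ge[of w] fr[of w] that \<open>\<delta> > 0\<close> \<eta> by (auto simp: closure_Un_frontier)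
  have "cmod (of_real \<eta> / u z) \<le> 1"
  proof (rule maximum_principle_AE_radial[where f = "\<lambda>w. of_real \<eta> / u w"])
    show Cb: "C \<subseteq> ball 0 1" using sub by (auto simp: sublevel_def)
    show "(\<lambda>w. of_real \<eta> / u w) holomorphic_on C"
      by (intro holomorphic_intros holomorphic_on_subset[OF inner_fun_holomorphic[OF u]])
         (use nz Cb closure_subset in blast)+
    show "continuous_on (closure C \<inter> ball 0 1) (\<lambda>w. of_real \<eta> / u w)"
      by (intro continuous_intros continuous_on_subset[OF inner_fun_continuous[OF u]]) (use nz in auto)
    show "cmod (of_real \<eta> / u w) \<le> \<eta> / \<delta>" if "w \<in> C" for w
      using ge[OF that] \<eta> \<open>\<delta> > 0\<close> by (auto simp: norm_divide intro!: divide_left_mono mult_pos_pos)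
    show "cmod (of_real \<eta> / u w) \<le> 1" if "w \<in> frontier C" "w \<in> ball 0 1" for w
      using fr[OF that] \<eta> by (simp add: norm_divide divide_le_eq_1)
    show "AE t in lebesgue_on {0..2*pi}. \<forall>\<^sub>F r in at_left 1. of_real r * cis t \<notin> C"
      using inner_fun_AE_norm_tendsto[OF u]
    proof eventually_elim
      case (elim t)
      from order_tendstoD(1)[OF elim \<open>\<eta> < 1\<close>] show ?case
        by eventually_elim (use sub in \<open>auto simp: sublevel_def\<close>)
    qed
  qed (use \<open>open C\<close> z in auto)
  then show False using z\<eta> \<eta> ge[OF z] \<open>\<delta> > 0\<close> by (auto simp: norm_divide divide_le_eq_1)
qed

section \<open>Division by a Blaschke factor\<close>

text \<open>The two maps differ by a unimodular constant, so estimates for Moebius maps carry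
  over.\<close>

lemma norm_blaschke_factor:
  "cmod (blaschke_factor a z) = cmod (Moebius_function 0 a z)"
  by (auto simp: blaschke_factor_def Moebius_function_simple norm_mult norm_divide norm_minus_commute)

lemma norm_blaschke_factor_less_1:
  "cmod a < 1 \<Longrightarrow> cmod z < 1 \<Longrightarrow> cmod (blaschke_factor a z) < 1"
  unfolding norm_blaschke_factor by (rule Moebius_function_norm_lt_1)

lemma blaschke_denominator_nonzero:
  assumes "cmod a < 1" "cmod z \<le> 1"
  shows "1 - cnj a * z \<noteq> 0"
proof
  assume "1 - cnj a * z = 0"
  then have "cmod a * cmod z = 1" by (metis complex_mod_cnj eq_iff_diff_eq_0 norm_mult norm_one)
  then show False using assms mult_left_le[of "cmod z" "cmod a"] by simp
qed

lemma norm_blaschke_factor_eq_1: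
  assumes "cmod a < 1" "cmod z = 1"
  shows "cmod (blaschke_factor a z) = 1"
proof -
  \<comment> \<open>The constant 1 is written as \<open>z * cnj z\<close>.\<close>
  have "1 - cnj a * z = z * cnj (z - a)"
    using assms(2) complex_norm_square[of z] by (simp add: algebra_simps)
  then have "cmod (1 - cnj a * z) = cmod (z - a)"
    using assms(2) by (simp only: norm_mult complex_mod_cnj)
  then show ?thesis
    using blaschke_denominator_nonzero[of a z] assms
    by (auto simp: norm_blaschke_factor Moebius_function_simple norm_divide)
qed

lemma continuous_on_blaschke_factor:
  assumes "cmod a < 1"
  shows "continuous_on (cball 0 1) (blaschke_factor a)"
proof (cases "a = 0")
  case True
  then show ?thesis by (simp add: blaschke_factor_def[abs_def])
next
  case False
  have "continuous_on (cball 0 1) (\<lambda>z. of_real (cmod a) / a * ((a - z) / (1 - cnj a * z)))"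
    by (intro continuous_intros) (use False blaschke_denominator_nonzero[OF assms] in auto)
  then show ?thesis using False by (simp add: blaschke_factor_def[abs_def])
qed

text \<open>The factor has modulus 1 on the unit circle, so the bound \<open>\<rho> < 1\<close>
  keeps this closed set off the circle.\<close>

lemma compact_blaschke_disc:
  assumes "cmod a < 1" "\<rho> < 1"
  shows "compact {z \<in> cball 0 1. cmod (blaschke_factor a z) \<le> \<rho>}" (is "compact ?K")
    and "{z \<in> cball 0 1. cmod (blaschke_factor a z) \<le> \<rho>} \<subseteq> ball 0 1"
proof -
  have "closed (cball 0 1 \<inter> (\<lambda>z. cmod (blaschke_factor a z)) -` {..\<rho>})"
    by (intro continuous_closed_preimage continuous_intros continuous_on_blaschke_factor assms) auto
  also have "cball 0 1 \<inter> (\<lambda>z. cmod (blaschke_factor a z)) -` {..\<rho>} = ?K" by auto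
  finally have "closed ?K" .
  moreover have "bounded ?K" by (rule bounded_subset[of "cball 0 1"]) auto
  ultimately show "compact ?K" by (simp add: compact_eq_bounded_closed)
  show "?K \<subseteq> ball 0 1"
    using norm_blaschke_factor_eq_1[of a] assms by (force simp: order_le_less)
qed

lemma blaschke_factor_eq_0_iff:
  assumes "cmod a < 1" "cmod z \<le> 1"
  shows "blaschke_factor a z = 0 \<longleftrightarrow> z = a"
  using blaschke_denominator_nonzero[OF assms] by (auto simp: blaschke_factor_def)

lemma remove_sings_divide_blaschke_factor:
  assumes hol: "f holomorphic_on ball 0 1" and a: "cmod a < 1" and fa: "f a = 0"
  defines "v \<equiv> remove_sings (\<lambda>z. f z / blaschke_factor a z)"
  shows "v holomorphic_on ball 0 1" and "z \<in> ball 0 1 \<Longrightarrow> f z = v z * blaschke_factor a z"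
proof -
  \<comment> \<open>\<open>V\<close> is the explicit quotient: \<open>h\<close> is
    \<open>f z / (z - a)\<close> with the singularity filled by the derivative, and \<open>c\<close>
    inverts the unimodular constant of the factor, with a sign from replacing \<open>a - z\<close>
    by \<open>z - a\<close> when \<open>a\<close> is nonzero.\<close>
  define h where "h z = (if z = a then deriv f a else f z / (z - a))" for z
  define c where "c = (if a = 0 then 1 else - a / of_real (cmod a))"
  define V where "V z = h z * c * (1 - cnj a * z)" for z
  have "h holomorphic_on ball 0 1"
    by (rule pole_theorem_open_0[OF hol, of a]) (auto simp: h_def fa)
  then have V: "V holomorphic_on ball 0 1"
    unfolding V_def by (intro holomorphic_intros)
  have V_eq: "f z / blaschke_factor a z = V z" if "z \<in> ball 0 1 - {a}" for z
    using that blaschke_denominator_nonzero[OF a, of z]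
    by (auto simp: V_def h_def c_def blaschke_factor_def divide_simps algebra_simps)
  \<comment> \<open>\<open>remove_sings\<close> takes the limit at each point, so continuity of
    \<open>V\<close> settles \<open>a\<close> and all other points at once.\<close>
  have v_eq: "v z = V z" if z: "z \<in> ball 0 1" for z
    unfolding v_def
  proof (rule remove_sings_eqI)
    have "V \<midarrow>z\<rightarrow> V z"
      using V z by (metis continuous_on_eq_continuous_at holomorphic_on_imp_continuous_on isContD open_ball)
    then show "(\<lambda>z. f z / blaschke_factor a z) \<midarrow>z\<rightarrow> V z"
    proof (rule Lim_transform_eventually)
      have "\<forall>\<^sub>F w in at z. w \<in> ball 0 1" using z by (intro eventually_at_in_open') auto
      moreover have "\<forall>\<^sub>F w in at z. w \<noteq> a" by (rule eventually_neq_at_within)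
      ultimately show "\<forall>\<^sub>F w in at z. V w = f w / blaschke_factor a w"
        by eventually_elim (use V_eq in auto)
    qed
  qed
  show "v holomorphic_on ball 0 1"
    using V by (rule holomorphic_transform) (simp add: v_eq)
  show "f z = v z * blaschke_factor a z" if z: "z \<in> ball 0 1"
  proof (cases "z = a")
    case True
    then show ?thesis using fa a blaschke_factor_eq_0_iff[OF a] by simp
  next
    case False
    then have "blaschke_factor a z \<noteq> 0" using blaschke_factor_eq_0_iff[OF a, of z] z by auto
    then show ?thesis using V_eq[of z] v_eq[OF z] False z by (auto simp: field_simps)
  qed
qed

text \<open>Boundedness comes from compactness where the factor is at most 1/2 in modulus, and from
  the bound on \<open>\<Theta>\<close> elsewhere. Radial limits can be divided because the factor
  extends continuously to the circle with modulus 1.\<close>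

lemma inner_fun_divide_blaschke_factor:
  assumes \<Theta>: "inner_fun \<Theta>" and a: "cmod a < 1" and v: "v holomorphic_on ball 0 1"
    and eq: "\<And>z. z \<in> ball 0 1 \<Longrightarrow> \<Theta> z = v z * blaschke_factor a z"
  shows "inner_fun v"
proof -
  define K where "K = {z \<in> cball 0 1. cmod (blaschke_factor a z) \<le> 1/2}"
  have K: "compact K" "K \<subseteq> ball 0 1"
    unfolding K_def by (intro compact_blaschke_disc a; simp)+
  have "bounded (v ` K)"
    by (intro compact_imp_bounded compact_continuous_image continuous_on_subset[OF holomorphic_on_imp_continuous_on[OF v]] K)
  then obtain B where B: "\<And>z. z \<in> K \<Longrightarrow> cmod (v z) \<le> B"
    unfolding bounded_iff by blast
  obtain M where M: "\<And>z. z \<in> ball 0 1 \<Longrightarrow> cmod (\<Theta> z) \<le> M"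
    using inner_fun_bounded[OF \<Theta>] unfolding bounded_iff by blast
  have "cmod (v z) \<le> max B (2 * M)" if z: "z \<in> ball 0 1" for z
  proof (cases "z \<in> K")
    case False
    then have "cmod (blaschke_factor a z) \<ge> 1/2" using z by (auto simp: K_def)
    then have "cmod (v z) * (1/2) \<le> cmod (v z) * cmod (blaschke_factor a z)"
      by (intro mult_left_mono) auto
    also have "\<dots> \<le> M" using M[OF z] eq[OF z] by (simp add: norm_mult)
    finally show ?thesis by simp
  qed (use B in fastforce)
  then have "bounded (v ` ball 0 1)" unfolding bounded_iff by blast
  moreover have "AE t in lebesgue_on {0..2*pi}. \<exists>l. has_radial_limit \<Theta> (cis t) l \<and> cmod l = 1"
    using \<Theta> by (simp add: inner_fun_def)
  then have "AE t in lebesgue_on {0..2*pi}. \<exists>l. has_radial_limit v (cis t) l \<and> cmod l = 1"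
  proof eventually_elim
    case (elim t)
    then obtain l where l: "((\<lambda>r. \<Theta> (of_real r * cis t)) \<longlongrightarrow> l) (at_left 1)" "cmod l = 1"
      by (auto simp: has_radial_limit_def)
    have in_ball: "\<forall>\<^sub>F r in at_left (1::real). of_real r * cis t \<in> ball 0 1"
      using eventually_at_left_real[of 0 1] by (auto elim!: eventually_mono simp: norm_mult)
    have b1: "cmod (blaschke_factor a (cis t)) = 1"
      using a by (simp add: norm_blaschke_factor_eq_1)
    have "((\<lambda>r. blaschke_factor a (of_real r * cis t)) \<longlongrightarrow> blaschke_factor a (cis t)) (at_left 1)"
    proof (rule continuous_on_tendsto_compose[OF continuous_on_blaschke_factor[OF a]])
      show "((\<lambda>r. of_real r * cis t) \<longlongrightarrow> cis t) (at_left 1)"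
        by (auto intro!: tendsto_eq_intros)
      show "\<forall>\<^sub>F r in at_left 1. of_real r * cis t \<in> cball 0 1"
        using in_ball by eventually_elim auto
    qed auto
    then have lim: "((\<lambda>r. \<Theta> (of_real r * cis t) / blaschke_factor a (of_real r * cis t))
        \<longlongrightarrow> l / blaschke_factor a (cis t)) (at_left 1)"
      and nz: "\<forall>\<^sub>F r in at_left 1. blaschke_factor a (of_real r * cis t) \<noteq> 0"
      using b1 by (auto intro!: tendsto_divide l tendsto_imp_eventually_ne)
    have "((\<lambda>r. v (of_real r * cis t)) \<longlongrightarrow> l / blaschke_factor a (cis t)) (at_left 1)"
      using lim
    proof (rule Lim_transform_eventually)
      show "\<forall>\<^sub>F r in at_left 1. \<Theta> (of_real r * cis t) / blaschke_factor a (of_real r * cis t)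
              = v (of_real r * cis t)"
        using in_ball nz by eventually_elim (simp add: eq)
    qed
    moreover have "cmod (l / blaschke_factor a (cis t)) = 1" using b1 l by (simp add: norm_divide)
    ultimately show ?case unfolding has_radial_limit_def by blast
  qed
  ultimately show ?thesis using v by (simp add: inner_fun_def Hinfty_def)
qed

section \<open>Connectedness through components, and the final argument\<close>

text \<open>A connected \<open>T\<close> lies in every component it meets, so there is at most one.
  If \<open>T\<close> is empty, \<open>S\<close> has no components and is empty too.\<close>

lemma connected_if_components_meet_connected_subset:
  assumes "connected T" "T \<subseteq> S" "\<And>C. C \<in> components S \<Longrightarrow> C \<inter> T \<noteq> {}"
  shows "connected S"
proof -
  have same: "C = D" if C: "C \<in> components S" and D: "D \<in> components S" for C D
  proof -
    have "T \<subseteq> C" "T \<subseteq> D"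
      using assms(3)[OF C] assms(3)[OF D] components_maximal[OF C assms(1,2)]
        components_maximal[OF D assms(1,2)] by (auto simp: Int_commute)
    then show ?thesis
      using assms(3)[OF C] components_nonoverlap[OF C D] by blast
  qed
  have "connected_component_set S x = connected_component_set S y" if "x \<in> S" "y \<in> S" for x y
    using that by (intro same componentsI)
  then show ?thesis
    by (metis connected_component_refl connected_iff_connected_component mem_Collect_eq)
qed

text \<open>Modulus 1 attained inside the disk forces constancy by the maximum modulus principle.
  This splits off the case in which \<open>v\<close> has no maximum modulus below 1 on compact
  sets.\<close>

lemma inner_fun_constant_or_norm_less_1:
  assumes "inner_fun v"
  shows "(\<exists>c. cmod c = 1 \<and> (\<forall>z\<in>ball 0 1. v z = c)) \<or> (\<forall>z\<in>ball 0 1. cmod (v z) < 1)"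
proof (cases "\<forall>z\<in>ball 0 1. cmod (v z) < 1")
  case False
  then obtain w where w: "w \<in> ball 0 1" "cmod (v w) = 1"
    using inner_fun_norm_le_1[OF assms] by (metis linorder_not_le order_antisym)
  have "v constant_on ball 0 1"
    by (rule maximum_modulus_principle[OF inner_fun_holomorphic[OF assms], of "ball 0 1" w])
       (use w inner_fun_norm_le_1[OF assms] in auto)
  then show ?thesis using w unfolding constant_on_def by metis
qed simp

theorem proposition3p1:
  fixes \<Theta> :: "complex \<Rightarrow> complex" and a :: complex
  assumes "\<Theta> \<in> one_component_inner"
    and "a \<in> ball 0 1"
    and "\<Theta> a = 0"
  shows "remove_sings (\<lambda>z. \<Theta> z / blaschke_factor a z) \<in> one_component_inner"
proof -
  define v where "v = remove_sings (\<lambda>z. \<Theta> z / blaschke_factor a z)"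
  have \<Theta>: "inner_fun \<Theta>" and a: "cmod a < 1"
    using assms by (auto simp: one_component_inner_def)
  note v_hol = remove_sings_divide_blaschke_factor(1)[OF inner_fun_holomorphic[OF \<Theta>] a assms(3),
      folded v_def]
  note eq = remove_sings_divide_blaschke_factor(2)[OF inner_fun_holomorphic[OF \<Theta>] a assms(3),
      folded v_def]
  have v: "inner_fun v"
    using \<Theta> a v_hol eq by (rule inner_fun_divide_blaschke_factor)
  \<comment> \<open>A unimodular constant cannot vanish at \<open>a\<close>, so the first
    alternative of the definition holds.\<close>
  obtain \<eta> where \<eta>: "0 < \<eta>" "\<eta> < 1" and conn: "connected (sublevel \<Theta> \<eta>)"
    using assms by (force simp: one_component_inner_def)
  have "\<exists>\<eta>'\<in>{0<..<1}. connected (sublevel v \<eta>')" if less: "\<forall>z\<in>ball 0 1. cmod (v z) < 1"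
  proof -
    \<comment> \<open>Any number strictly between \<open>\<eta>\<close> and 1 serves: it makes
      \<open>\<eta> / \<rho> < 1\<close> while \<open>K\<close> stays compact in the disk.\<close>
    define \<rho> where "\<rho> = (1 + \<eta>) / 2"
    have \<rho>: "\<eta> < \<rho>" "\<rho> < 1" "0 < \<rho>" using \<eta> by (auto simp: \<rho>_def)
    define K where "K = {z \<in> cball 0 1. cmod (blaschke_factor a z) \<le> \<rho>}"
    have K: "compact K" "K \<subseteq> ball 0 1"
      unfolding K_def by (intro compact_blaschke_disc a \<rho>)+
    have "a \<in> K" using a \<rho> blaschke_factor_eq_0_iff[OF a, of a] by (simp add: K_def)
    then obtain z1 where z1: "z1 \<in> K" "\<And>z. z \<in> K \<Longrightarrow> cmod (v z) \<le> cmod (v z1)"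
      using continuous_attains_sup[of K "\<lambda>z. cmod (v z)"] K
      by (metis continuous_on_norm continuous_on_subset empty_iff inner_fun_continuous v)
    have "max (\<eta> / \<rho>) (cmod (v z1)) < 1"
      using less z1(1) K \<rho> by auto
    then obtain \<eta>' where \<eta>': "\<eta> / \<rho> < \<eta>'" "cmod (v z1) < \<eta>'" "\<eta>' < 1"
      using dense[of "max (\<eta> / \<rho>) (cmod (v z1))" 1] by auto
    have sub: "sublevel \<Theta> \<eta> \<subseteq> sublevel v \<eta>'"
    proof
      fix z assume "z \<in> sublevel \<Theta> \<eta>"
      then have z: "z \<in> ball 0 1" "cmod (v z) * cmod (blaschke_factor a z) < \<eta>"
        using eq[of z] by (auto simp: sublevel_def norm_mult)
      have "cmod (v z) < \<eta>'"
      proof (cases "z \<in> K")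
        case True
        then show ?thesis using z1(2) \<eta>' by force
      next
        case False
        then have "cmod (v z) * \<rho> \<le> cmod (v z) * cmod (blaschke_factor a z)"
          using z by (intro mult_left_mono) (auto simp: K_def)
        then have "cmod (v z) < \<eta> / \<rho>" using z \<rho> by (simp add: pos_less_divide_eq)
        then show ?thesis using \<eta>' by linarith
      qed
      then show "z \<in> sublevel v \<eta>'" using z by (simp add: sublevel_def)
    qed
    have "connected (sublevel v \<eta>')"
      using conn sub
    proof (rule connected_if_components_meet_connected_subset)
      fix C assume C: "C \<in> components (sublevel v \<eta>')"
      \<comment> \<open>The smallness threshold is the original \<open>\<eta>\<close>: since
        \<open>cmod (\<Theta> z) \<le> cmod (v z)\<close>, such a point lies in
        \<open>sublevel \<Theta> \<eta>\<close>.\<close>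
      obtain z where z: "z \<in> C" "cmod (v z) < \<eta>"
        using inner_fun_small_on_components[OF v C \<eta>'(3) \<eta>(1)] by blast
      then have zb: "z \<in> ball 0 1" using in_components_subset[OF C] by (auto simp: sublevel_def)
      have "cmod (\<Theta> z) \<le> cmod (v z)"
        using eq[OF zb] norm_blaschke_factor_less_1[OF a, of z] zb
        by (simp add: norm_mult mult_left_le)
      then show "C \<inter> sublevel \<Theta> \<eta> \<noteq> {}" using z zb by (auto simp: sublevel_def)
    qed
    moreover have "\<eta>' > 0" using \<eta>' norm_ge_zero[of "v z1"] by linarith
    ultimately show ?thesis using \<eta>' by auto
  qed
  then show ?thesis
    using v inner_fun_constant_or_norm_less_1[OF v]
    unfolding one_component_inner_def v_def[symmetric] by blast
qed

end
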